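(* Let $M^2: z=z(u,v)$ be a surface in $\mathbb R^4$ without flat points, let $p\in M^2$, and let $\nu'$ and $\nu''$ be the principal normal curvatures of $M^2$ at $p$, i.e. the normal curvatures of two mutually perpendicular principal tangents at $p$. Then the invariants $k$ and $\varkappa$ of $M^2$ at $p$ satisfy $$k=\nu'\nu'',\qquad \varkappa=\frac{\nu'+\nu''}{2}.$$
   Context: $M^2: z=z(u,v)$, $(u,v)\in\mathcal D\subset\mathbb R^2$, is a smooth regular 2-dimensional surface in Euclidean $\mathbb R^4$, with tangent space $T_pM^2=\mathrm{span}\{z_u,z_v\}$. $E,F,G$ are the coefficients of the first fundamental form $I(\lambda,\mu)=E\lambda^2+2F\lambda\mu+G\mu^2$, and $W=\sqrt{EG-F^2}$. $\{e_1,e_2\}$ is an orthonormal normal frame field chosen so that $\{z_u,z_v,e_1,e_2\}$ is positively oriented in $\mathbb R^4$. $\sigma$ is the vector-valued second fundamental tensor (normal part of the second derivative). The oriented area of the parallelogram of an ordered pair of normal vectors is $S(a^1e_1+a^2e_2,\;b^1e_1+b^2e_2)=a^1b^2-a^2b^1$. Put $L=\frac{2}{W}S(\sigma(z_u,z_u),\sigma(z_u,z_v))$, $M=\frac{1}{W}S(\sigma(z_u,z_u),\sigma(z_v,z_v))$, $N=\frac{2}{W}S(\sigma(z_u,z_v),\sigma(z_v,z_v))$. A point is flat if $L=M=N=0$ there. The second fundamental form is $II(\lambda,\mu)=L\lambda^2+2M\lambda\mu+N\mu^2$. The invariants are $$k=\frac{LN-M^2}{EG-F^2},\qquad \varkappa=\frac{EN+GL-2FM}{2(EG-F^2)}.$$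 A tangent $g$ at $p$ is a line in $T_pM^2$ determined by a nonzero vector $X=\lambda z_u+\mu z_v$. Its normal curvature is $\nu_g=\frac{II(\lambda,\mu)}{I(\lambda,\mu)}$. Two tangents determined by $\lambda_iz_u+\mu_iz_v$ ($i=1,2$) are conjugate if $L\lambda_1\lambda_2+M(\lambda_1\mu_2+\lambda_2\mu_1)+N\mu_1\mu_2=0$. A tangent is principal if it is perpendicular to its conjugate, i.e. if there is a tangent conjugate to it and perpendicular to it; equivalently $(EM-FL)\lambda^2+(EN-GL)\lambda\mu+(FN-GM)\mu^2=0$. (In parameters with $F=M=0$ the parametric directions are principal and $\nu'=L/E$, $\nu''=N/G$.) *)

theory Defs
  imports "HOL-Analysis.Analysis"
begin

text \<open>Surfaces are parametrised by maps \<open>z\<close> from the \<open>(u,v)\<close>-plane to \<open>\<real>\<^sup>4\<close>. A tangent vector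
  \<open>\<lambda> z\<^sub>u + \<mu> z\<^sub>v\<close> is represented by its coordinate pair \<open>(\<lambda>, \<mu>)\<close>.\<close>

type_synonym point2 = "real \<times> real"
type_synonym surface = "point2 \<Rightarrow> real ^ 4"
type_synonym normal_field = "point2 \<Rightarrow> real ^ 4"

text \<open>The directional derivatives of \<open>f\<close> are the values of its Frechet derivative, so the recursion
  below says that \<open>f\<close> has continuous derivatives up to order \<open>n\<close>. It is meant for open \<open>D\<close>.\<close>

primrec Ck_on :: "nat \<Rightarrow> point2 set \<Rightarrow> (point2 \<Rightarrow> real ^ 4) \<Rightarrow> bool" where
  "Ck_on 0 D f \<longleftrightarrow> continuous_on D f"
| "Ck_on (Suc n) D f \<longleftrightarrow>
     (\<forall>p\<in>D. f differentiable (at p)) \<and>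
     (\<forall>h. Ck_on n D (\<lambda>p. frechet_derivative f (at p) h))"

definition smooth_map_on :: "point2 set \<Rightarrow> (point2 \<Rightarrow> real ^ 4) \<Rightarrow> bool" where
  "smooth_map_on D f \<longleftrightarrow> (\<forall>n. Ck_on n D f)"

definition z_u :: "surface \<Rightarrow> point2 \<Rightarrow> real ^ 4" where
  "z_u z p = frechet_derivative z (at p) (1, 0)"

definition z_v :: "surface \<Rightarrow> point2 \<Rightarrow> real ^ 4" where
  "z_v z p = frechet_derivative z (at p) (0, 1)"

text \<open>\<open>independent\<close> speaks about a set, hence the extra conjunct \<open>z\<^sub>u \<noteq> z\<^sub>v\<close>.\<close>

definition regular_surface :: "point2 set \<Rightarrow> surface \<Rightarrow> bool" where
  "regular_surface D z \<longleftrightarrow> open D \<and> smooth_map_on D z \<and>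
     (\<forall>p\<in>D. z_u z p \<noteq> z_v z p \<and> independent {z_u z p, z_v z p})"

definition tangent_space :: "surface \<Rightarrow> point2 \<Rightarrow> (real ^ 4) set" where
  "tangent_space z p = span {z_u z p, z_v z p}"

definition tangent_vec :: "surface \<Rightarrow> point2 \<Rightarrow> point2 \<Rightarrow> real ^ 4" where
  "tangent_vec z p X = fst X *\<^sub>R z_u z p + snd X *\<^sub>R z_v z p"

definition E_coeff :: "surface \<Rightarrow> point2 \<Rightarrow> real" where
  "E_coeff z p = z_u z p \<bullet> z_u z p"

definition F_coeff :: "surface \<Rightarrow> point2 \<Rightarrow> real" where
  "F_coeff z p = z_u z p \<bullet> z_v z p"

definition G_coeff :: "surface \<Rightarrow> point2 \<Rightarrow> real" where
  "G_coeff z p = z_v z p \<bullet> z_v z p"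

definition W_coeff :: "surface \<Rightarrow> point2 \<Rightarrow> real" where
  "W_coeff z p = sqrt (E_coeff z p * G_coeff z p - (F_coeff z p)\<^sup>2)"

definition first_form :: "surface \<Rightarrow> point2 \<Rightarrow> point2 \<Rightarrow> real" where
  "first_form z p X =
     E_coeff z p * (fst X)\<^sup>2 + 2 * F_coeff z p * fst X * snd X + G_coeff z p * (snd X)\<^sup>2"

definition adapted_normal_frame ::
    "point2 set \<Rightarrow> surface \<Rightarrow> normal_field \<Rightarrow> normal_field \<Rightarrow> bool" where
  "adapted_normal_frame D z e1 e2 \<longleftrightarrow> (\<forall>p\<in>D.
     norm (e1 p) = 1 \<and> norm (e2 p) = 1 \<and> orthogonal (e1 p) (e2 p) \<and>
     (\<forall>t\<in>tangent_space z p. orthogonal (e1 p) t \<and> orthogonal (e2 p) t) \<and>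
     det (vector [z_u z p, z_v z p, e1 p, e2 p] :: real ^ 4 ^ 4) > 0)"

definition normal_part :: "surface \<Rightarrow> point2 \<Rightarrow> real ^ 4 \<Rightarrow> real ^ 4" where
  "normal_part z p w = (THE n. (\<forall>t\<in>tangent_space z p. orthogonal n t) \<and> w - n \<in> tangent_space z p)"

definition second_derivative :: "surface \<Rightarrow> point2 \<Rightarrow> point2 \<Rightarrow> point2 \<Rightarrow> real ^ 4" where
  "second_derivative z p X Y =
     frechet_derivative (\<lambda>q. frechet_derivative z (at q) X) (at p) Y"

definition sigma :: "surface \<Rightarrow> point2 \<Rightarrow> point2 \<Rightarrow> point2 \<Rightarrow> real ^ 4" where
  "sigma z p X Y = normal_part z p (second_derivative z p X Y)"

text \<open>The components of a normal vector in the orthonormal frame \<open>n1, n2\<close> are its inner products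
  with \<open>n1\<close> and \<open>n2\<close>.\<close>

definition oriented_area :: "real ^ 4 \<Rightarrow> real ^ 4 \<Rightarrow> real ^ 4 \<Rightarrow> real ^ 4 \<Rightarrow> real" where
  "oriented_area n1 n2 a b = (a \<bullet> n1) * (b \<bullet> n2) - (a \<bullet> n2) * (b \<bullet> n1)"

definition L_coeff :: "surface \<Rightarrow> normal_field \<Rightarrow> normal_field \<Rightarrow> point2 \<Rightarrow> real" where
  "L_coeff z e1 e2 p = 2 / W_coeff z p *
     oriented_area (e1 p) (e2 p) (sigma z p (1, 0) (1, 0)) (sigma z p (1, 0) (0, 1))"

definition M_coeff :: "surface \<Rightarrow> normal_field \<Rightarrow> normal_field \<Rightarrow> point2 \<Rightarrow> real" where
  "M_coeff z e1 e2 p = 1 / W_coeff z p *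
     oriented_area (e1 p) (e2 p) (sigma z p (1, 0) (1, 0)) (sigma z p (0, 1) (0, 1))"

definition N_coeff :: "surface \<Rightarrow> normal_field \<Rightarrow> normal_field \<Rightarrow> point2 \<Rightarrow> real" where
  "N_coeff z e1 e2 p = 2 / W_coeff z p *
     oriented_area (e1 p) (e2 p) (sigma z p (1, 0) (0, 1)) (sigma z p (0, 1) (0, 1))"

definition flat_point :: "surface \<Rightarrow> normal_field \<Rightarrow> normal_field \<Rightarrow> point2 \<Rightarrow> bool" where
  "flat_point z e1 e2 p \<longleftrightarrow>
     L_coeff z e1 e2 p = 0 \<and> M_coeff z e1 e2 p = 0 \<and> N_coeff z e1 e2 p = 0"

definition second_form :: "surface \<Rightarrow> normal_field \<Rightarrow> normal_field \<Rightarrow> point2 \<Rightarrow> point2 \<Rightarrow> real" where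
  "second_form z e1 e2 p X =
     L_coeff z e1 e2 p * (fst X)\<^sup>2 + 2 * M_coeff z e1 e2 p * fst X * snd X
       + N_coeff z e1 e2 p * (snd X)\<^sup>2"

definition k_invariant :: "surface \<Rightarrow> normal_field \<Rightarrow> normal_field \<Rightarrow> point2 \<Rightarrow> real" where
  "k_invariant z e1 e2 p =
     (L_coeff z e1 e2 p * N_coeff z e1 e2 p - (M_coeff z e1 e2 p)\<^sup>2)
       / (E_coeff z p * G_coeff z p - (F_coeff z p)\<^sup>2)"

definition kappa_invariant :: "surface \<Rightarrow> normal_field \<Rightarrow> normal_field \<Rightarrow> point2 \<Rightarrow> real" where
  "kappa_invariant z e1 e2 p =
     (E_coeff z p * N_coeff z e1 e2 p + G_coeff z p * L_coeff z e1 e2 p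
        - 2 * F_coeff z p * M_coeff z e1 e2 p)
       / (2 * (E_coeff z p * G_coeff z p - (F_coeff z p)\<^sup>2))"

text \<open>A tangent is given by the coordinates \<open>X \<noteq> 0\<close> of a vector that determines it. The notions
  below do not change when \<open>X\<close> is replaced by a nonzero multiple.\<close>

definition normal_curvature :: "surface \<Rightarrow> normal_field \<Rightarrow> normal_field \<Rightarrow> point2 \<Rightarrow> point2 \<Rightarrow> real" where
  "normal_curvature z e1 e2 p X = second_form z e1 e2 p X / first_form z p X"

definition conjugate_tangents ::
    "surface \<Rightarrow> normal_field \<Rightarrow> normal_field \<Rightarrow> point2 \<Rightarrow> point2 \<Rightarrow> point2 \<Rightarrow> bool" where
  "conjugate_tangents z e1 e2 p X Y \<longleftrightarrow>
     L_coeff z e1 e2 p * fst X * fst Y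
       + M_coeff z e1 e2 p * (fst X * snd Y + fst Y * snd X)
       + N_coeff z e1 e2 p * snd X * snd Y = 0"

definition perpendicular_tangents :: "surface \<Rightarrow> point2 \<Rightarrow> point2 \<Rightarrow> point2 \<Rightarrow> bool" where
  "perpendicular_tangents z p X Y \<longleftrightarrow> orthogonal (tangent_vec z p X) (tangent_vec z p Y)"

definition principal_tangent ::
    "surface \<Rightarrow> normal_field \<Rightarrow> normal_field \<Rightarrow> point2 \<Rightarrow> point2 \<Rightarrow> bool" where
  "principal_tangent z e1 e2 p X \<longleftrightarrow> X \<noteq> 0 \<and>
     (\<exists>Y. Y \<noteq> 0 \<and> conjugate_tangents z e1 e2 p X Y \<and> perpendicular_tangents z p X Y)"

end

theory Submission
  imports Defs
begin

text \<open>
  Only the values at \<open>p\<close> of the two quadratic forms \<open>I\<close> and \<open>II\<close> on the tangent plane matter.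
  In the basis formed by the principal vectors \<open>X\<close> and \<open>Y\<close> both are diagonal: \<open>I(X,Y) = 0\<close> is
  perpendicularity, and \<open>II(X,Y) = 0\<close> holds because the perpendicular of \<open>X\<close> in the plane is a line,
  so that the tangent which witnesses that \<open>X\<close> is principal must be the one determined by \<open>Y\<close>
  (\<open>principal_perpendicular_conjugate\<close>).

  The numbers \<open>EG - F\<^sup>2\<close>, \<open>LN - M\<^sup>2\<close> and \<open>EN + GL - 2FM\<close> are the two discriminants and their
  polarisation, so a change of basis multiplies all three by the same factor, the square of its
  determinant (\<open>polar_discriminant_change_of_basis\<close>). Both \<open>k\<close> and \<open>\<kappa>\<close> are quotients in which this
  factor cancels, and in the diagonalising basis they are
  \<open>II(X) II(Y) / (I(X) I(Y))\<close> and \<open>(I(X) II(Y) + II(X) I(Y)) / (2 I(X) I(Y))\<close>.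
\<close>

definition binary_form :: "real \<Rightarrow> real \<Rightarrow> real \<Rightarrow> point2 \<Rightarrow> point2 \<Rightarrow> real" where
  "binary_form A B C X Y =
     A * fst X * fst Y + B * (fst X * snd Y + fst Y * snd X) + C * snd X * snd Y"

text \<open>The determinant of a Gram matrix is quadratic in the form, and this is its polarised version;
  equal forms give back twice the discriminant law.\<close>

lemma polar_discriminant_change_of_basis:
  fixes X Y :: point2
  shows "(A * C' + C * A' - 2 * B * B') * (fst X * snd Y - snd X * fst Y)\<^sup>2 =
    binary_form A B C X X * binary_form A' B' C' Y Y
    + binary_form A' B' C' X X * binary_form A B C Y Y
    - 2 * binary_form A B C X Y * binary_form A' B' C' X Y"
  unfolding binary_form_def by algebra

lemma discriminant_change_of_basis:
  fixes X Y :: point2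
  shows "(A * C - B\<^sup>2) * (fst X * snd Y - snd X * fst Y)\<^sup>2 =
    binary_form A B C X X * binary_form A B C Y Y - (binary_form A B C X Y)\<^sup>2"
  using polar_discriminant_change_of_basis[of A C C A B B X Y]
  by (simp add: power2_eq_square algebra_simps)

text \<open>The vectors orthogonal to \<open>X\<close> are the solutions of one nonzero linear equation in two unknowns,
  hence they form a line.\<close>

lemma orthogonal_line:
  fixes X Y Z :: point2
  assumes nz: "binary_form A B C X X \<noteq> 0"
    and Y: "binary_form A B C X Y = 0" and Z: "binary_form A B C X Z = 0"
    and "Y \<noteq> 0"
  obtains s where "Z = s *\<^sub>R Y"
proof -
  define \<alpha> where "\<alpha> = A * fst X + B * snd X"
  define \<beta> where "\<beta> = B * fst X + C * snd X"
  have pairing: "binary_form A B C X V = \<alpha> * fst V + \<beta> * snd V" for V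
    by (simp add: binary_form_def \<alpha>_def \<beta>_def algebra_simps)
  have "\<alpha> \<noteq> 0 \<or> \<beta> \<noteq> 0"
    using nz by (auto simp: pairing)
  moreover have "\<alpha> * (fst Y * snd Z - snd Y * fst Z) = 0" "\<beta> * (fst Y * snd Z - snd Y * fst Z) = 0"
    using Y Z unfolding pairing by algebra+
  ultimately have par: "fst Y * snd Z = snd Y * fst Z"
    by auto
  show thesis
  proof (cases "fst Y = 0")
    case True
    with \<open>Y \<noteq> 0\<close> have "snd Y \<noteq> 0"
      by (simp add: prod_eq_iff)
    with True par have "Z = (snd Z / snd Y) *\<^sub>R Y"
      by (simp add: prod_eq_iff)
    then show thesis
      by (rule that)
  next
    case False
    with par have "Z = (fst Z / fst Y) *\<^sub>R Y"
      by (simp add: prod_eq_iff field_simps)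
    then show thesis
      by (rule that)
  qed
qed

text \<open>The bilinear versions of the two forms make conjugate and perpendicular tangents into the same
  kind of condition.\<close>

abbreviation first_bilinear :: "surface \<Rightarrow> point2 \<Rightarrow> point2 \<Rightarrow> point2 \<Rightarrow> real" where
  "first_bilinear z p \<equiv> binary_form (E_coeff z p) (F_coeff z p) (G_coeff z p)"

abbreviation second_bilinear ::
    "surface \<Rightarrow> normal_field \<Rightarrow> normal_field \<Rightarrow> point2 \<Rightarrow> point2 \<Rightarrow> point2 \<Rightarrow> real" where
  "second_bilinear z e1 e2 p \<equiv>
     binary_form (L_coeff z e1 e2 p) (M_coeff z e1 e2 p) (N_coeff z e1 e2 p)"

lemma first_form_eq: "first_form z p X = first_bilinear z p X X"
  by (simp add: first_form_def binary_form_def power2_eq_square)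

lemma second_form_eq: "second_form z e1 e2 p X = second_bilinear z e1 e2 p X X"
  by (simp add: second_form_def binary_form_def power2_eq_square)

lemma first_bilinear_eq_inner:
  "first_bilinear z p X Y = tangent_vec z p X \<bullet> tangent_vec z p Y"
  by (simp add: binary_form_def tangent_vec_def E_coeff_def F_coeff_def G_coeff_def
      inner_add_left inner_add_right inner_commute algebra_simps)

lemma perpendicular_tangents_iff: "perpendicular_tangents z p X Y \<longleftrightarrow> first_bilinear z p X Y = 0"
  by (simp add: perpendicular_tangents_def orthogonal_def first_bilinear_eq_inner)

lemma conjugate_tangents_iff: "conjugate_tangents z e1 e2 p X Y \<longleftrightarrow> second_bilinear z e1 e2 p X Y = 0"
  by (simp add: conjugate_tangents_def binary_form_def)

lemma first_bilinear_pos: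
  assumes "regular_surface D z" and "p \<in> D" and "X \<noteq> 0"
  shows "first_bilinear z p X X > 0"
proof -
  have ne: "z_u z p \<noteq> z_v z p" and ind: "independent {z_u z p, z_v z p}"
    using assms by (auto simp: regular_surface_def)
  have "tangent_vec z p X \<noteq> 0"
  proof
    assume zero: "tangent_vec z p X = 0"
    define c where "c w = (if w = z_u z p then fst X else snd X)" for w
    have "(\<Sum>w\<in>{z_u z p, z_v z p}. c w *\<^sub>R w) = 0"
      using zero ne by (auto simp: c_def tangent_vec_def)
    then have "c (z_u z p) = 0" "c (z_v z p) = 0"
      using independentD[OF ind _ subset_refl] by auto
    with ne have "X = 0"
      by (auto simp: c_def prod_eq_iff)
    with \<open>X \<noteq> 0\<close> show False ..
  qed
  then show ?thesis
    by (simp add: first_bilinear_eq_inner)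
qed

text \<open>A principal tangent has only one perpendicular tangent, so that one is also conjugate to it.\<close>

lemma principal_perpendicular_conjugate:
  assumes "regular_surface D z" and "p \<in> D"
    and principal: "principal_tangent z e1 e2 p X"
    and "Y \<noteq> 0" and perp: "perpendicular_tangents z p X Y"
  shows "conjugate_tangents z e1 e2 p X Y"
proof -
  from principal obtain Z where "X \<noteq> 0" "Z \<noteq> 0"
    and conj: "conjugate_tangents z e1 e2 p X Z" and perpZ: "perpendicular_tangents z p X Z"
    by (auto simp: principal_tangent_def)
  have "first_bilinear z p X X \<noteq> 0"
    using first_bilinear_pos[OF assms(1,2) \<open>X \<noteq> 0\<close>] by simp
  then obtain s where s: "Z = s *\<^sub>R Y"
    using orthogonal_line perp perpZ \<open>Y \<noteq> 0\<close> unfolding perpendicular_tangents_iff by metis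
  with \<open>Z \<noteq> 0\<close> have "s \<noteq> 0"
    by auto
  have "second_bilinear z e1 e2 p X Z = s * second_bilinear z e1 e2 p X Y"
    by (simp add: s binary_form_def algebra_simps)
  with conj \<open>s \<noteq> 0\<close> show ?thesis
    by (simp add: conjugate_tangents_iff)
qed

theorem mainTheorem5:
  fixes D :: "(real \<times> real) set"
    and z e1 e2 :: "real \<times> real \<Rightarrow> real ^ 4"
    and p X Y :: "real \<times> real"
    and \<nu>1 \<nu>2 :: real
  assumes "regular_surface D z"
    and "adapted_normal_frame D z e1 e2"
    and "\<forall>q\<in>D. \<not> flat_point z e1 e2 q"
    and "p \<in> D"
    and "principal_tangent z e1 e2 p X"
    and "principal_tangent z e1 e2 p Y"
    and "perpendicular_tangents z p X Y"
    and "\<nu>1 = normal_curvature z e1 e2 p X"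
    and "\<nu>2 = normal_curvature z e1 e2 p Y"
  shows "k_invariant z e1 e2 p = \<nu>1 * \<nu>2 \<and> kappa_invariant z e1 e2 p = (\<nu>1 + \<nu>2) / 2"
proof -
  have X: "X \<noteq> 0" and Y: "Y \<noteq> 0"
    using assms(5,6) by (auto simp: principal_tangent_def)
  define a where "a = first_bilinear z p X X"
  define b where "b = first_bilinear z p Y Y"
  define c where "c = second_bilinear z e1 e2 p X X"
  define d where "d = second_bilinear z e1 e2 p Y Y"
  define t where "t = (fst X * snd Y - snd X * fst Y)\<^sup>2"
  define disc where "disc = E_coeff z p * G_coeff z p - (F_coeff z p)\<^sup>2"
  have a: "a > 0" and b: "b > 0"
    unfolding a_def b_def using first_bilinear_pos[OF assms(1,4)] X Y by auto
  have I: "first_bilinear z p X Y = 0"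
    using assms(7) by (simp add: perpendicular_tangents_iff)
  have II: "second_bilinear z e1 e2 p X Y = 0"
    using principal_perpendicular_conjugate[OF assms(1,4,5) Y assms(7)]
    by (simp add: conjugate_tangents_iff)
  have gram: "disc * t = a * b"
    by (simp add: disc_def t_def discriminant_change_of_basis I a_def b_def)
  (* The Gram determinant of X, Y is positive, so X and Y are a basis and I is nondegenerate. *)
  have disc: "disc \<noteq> 0" and t: "t \<noteq> 0"
    using gram a b by auto
  have "k_invariant z e1 e2 p = (k_invariant z e1 e2 p * disc) * t / (disc * t)"
    using disc t by simp
  also have "(k_invariant z e1 e2 p * disc) * t = c * d"
    using disc by (simp add: k_invariant_def disc_def t_def discriminant_change_of_basis II c_def d_def)
  finally have k: "k_invariant z e1 e2 p = c * d / (a * b)"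
    by (simp add: gram)
  have "kappa_invariant z e1 e2 p = (kappa_invariant z e1 e2 p * (2 * disc)) * t / (2 * (disc * t))"
    using disc t by simp
  also have "kappa_invariant z e1 e2 p * (2 * disc) =
      E_coeff z p * N_coeff z e1 e2 p + G_coeff z p * L_coeff z e1 e2 p
      - 2 * F_coeff z p * M_coeff z e1 e2 p"
    using disc by (simp add: kappa_invariant_def disc_def)
  also have "\<dots> * t = a * d + c * b"
    by (simp add: t_def polar_discriminant_change_of_basis I II a_def b_def c_def d_def)
  finally have kappa: "kappa_invariant z e1 e2 p = (a * d + c * b) / (2 * (a * b))"
    by (simp add: gram)
  have \<nu>: "\<nu>1 = c / a" "\<nu>2 = d / b"
    by (simp_all add: assms(8,9) normal_curvature_def first_form_eq second_form_eq
        a_def b_def c_def d_def)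
  show ?thesis
    unfolding \<nu> k kappa using a b by (simp add: field_simps)
qed

end
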